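(* Let $A\in\mathbb{R}^{n\times n}$ be symmetric positive definite with eigenvalues $\lambda_1\le\cdots\le\lambda_n$ and eigenvectors $u_1,\dots,u_n$ with $(u_i,u_j)_A=\delta_{ij}$. Let $\mathcal K\subset\mathbb{R}^n$ be an $m$-dimensional subspace with approximate (Ritz) eigenpairs $(\widetilde\lambda_j,\widetilde u_j)$, $j=1,\dots,m$, and put $\mu_i=1/\lambda_i$, $\widetilde\mu_j=1/\widetilde\lambda_j$. Let $1\le k<m$ and suppose that the first $k$ eigenvalues $\lambda_1\le\cdots\le\lambda_k$ are closest to the approximations $\widetilde\lambda_1\le\cdots\le\widetilde\lambda_k$, i.e. $|\widetilde\lambda_i-\lambda_i|\le|\widetilde\lambda_j-\lambda_i|$ for all $1\le i\le k<j\le m$. Define $E_{m,k}:\mathbb{R}^n\to\mathrm{span}\{\widetilde u_1,\dots,\widetilde u_k\}$ by $$(E_{m,k}w,\widetilde u_i)_A=(w,\widetilde u_i)_A\qquad\forall w\in\mathbb{R}^n,\ i=1,\dots,k,$$ and define $$\eta_{\mathcal K}:=\sup_{\|g\|_2=1}\|(I-\mathcal P_{\mathcal K})A^{-1}g\|_A,\qquad \delta_{k,i}:=\min_{k<j\le m}|\widetilde\mu_j-\mu_i|=\min_{k<j\le m}\Big|\frac1{\widetilde\lambda_j}-\frac1{\lambda_i}\Big|,$$ and assume $\delta_{k,i}>0$ for $1\le i\le k$. Then for $1\le i\le k$, $$\|u_i-E_{m,k}u_i\|_A\le\sqrt{1+\frac{\widetilde\mu_{k+1}}{\delta_{k,i}^2}\,\eta_{\mathcal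 K}^2}\;\|(I-\mathcal P_{\mathcal K})u_i\|_A,$$ and furthermore $$\|u_i-E_{m,k}u_i\|_2\le\eta_{\mathcal K,k,i}\,\|u_i-E_{m,k}u_i\|_A,\qquad\text{where}\quad \eta_{\mathcal K,k,i}:=\Big(1+\frac{\widetilde\mu_{k+1}}{\delta_{k,i}}\Big)\eta_{\mathcal K}.$$
   Context: For $x,y\in\mathbb{R}^n$: $(x,y)=x^Ty$, $(x,y)_A=x^TAy$, $\|x\|_2=\sqrt{(x,x)}$, $\|x\|_A=\sqrt{(x,x)_A}$. The projection $\mathcal P_{\mathcal K}:\mathbb{R}^n\to\mathcal K$ is the $A$-orthogonal projection: $(\mathcal P_{\mathcal K}x,y)_A=(x,y)_A$ for all $x\in\mathbb{R}^n$, $y\in\mathcal K$. The approximate (Ritz) eigenpairs on $\mathcal K$ are the pairs $(\widetilde\lambda_j,\widetilde u_j)\in\mathbb{R}\times\mathcal K$, $j=1,\dots,m$, satisfying $(A\widetilde u_j-\widetilde\lambda_j\widetilde u_j,v)=0$ for all $v\in\mathcal K$, ordered so that $\widetilde\lambda_1\le\cdots\le\widetilde\lambda_m$ (counted with multiplicity) and normalized by $(\widetilde u_j,\widetilde u_l)_A=\delta_{jl}$. Here $\delta_{ij}$ with both indices of the orthonormality relations is the Kronecker delta, while $\delta_{k,i}$ (with a comma) is the gap defined in the claim. *)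

theory Defs
  imports "HOL-Analysis.Analysis"
begin

definition spd_matrix :: "real ^ 'n ^ 'n \<Rightarrow> bool" where
  "spd_matrix A \<longleftrightarrow> transpose A = A \<and> (\<forall>x. x \<noteq> 0 \<longrightarrow> x \<bullet> (A *v x) > 0)"

definition A_inner :: "real ^ 'n ^ 'n \<Rightarrow> real ^ 'n \<Rightarrow> real ^ 'n \<Rightarrow> real" where
  "A_inner A x y = x \<bullet> (A *v y)"

definition A_norm :: "real ^ 'n ^ 'n \<Rightarrow> real ^ 'n \<Rightarrow> real" where
  "A_norm A x = sqrt (A_inner A x x)"

text \<open>Families of eigenpairs are indexed by \<open>1, \<dots>, n\<close> (values at other indices are irrelevant).
  As the \<open>n = CARD('n)\<close> vectors are orthonormal, every eigenvalue is listed with its multiplicity;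
  likewise below for the Ritz values when \<open>dim K = m\<close>.\<close>

definition eigenpairs :: "real ^ 'n ^ 'n \<Rightarrow> (nat \<Rightarrow> real) \<Rightarrow> (nat \<Rightarrow> real ^ 'n) \<Rightarrow> bool" where
  "eigenpairs A lam u \<longleftrightarrow>
     (\<forall>i\<in>{1..CARD('n)}. A *v u i = lam i *\<^sub>R u i) \<and>
     (\<forall>i\<in>{1..CARD('n)}. \<forall>j\<in>{1..CARD('n)}. A_inner A (u i) (u j) = (if i = j then 1 else 0)) \<and>
     mono_on {1..CARD('n)} lam"

definition ritz_pairs ::
  "real ^ 'n ^ 'n \<Rightarrow> (real ^ 'n) set \<Rightarrow> nat \<Rightarrow> (nat \<Rightarrow> real) \<Rightarrow> (nat \<Rightarrow> real ^ 'n) \<Rightarrow> bool" where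
  "ritz_pairs A K m lam' u' \<longleftrightarrow>
     (\<forall>j\<in>{1..m}. u' j \<in> K \<and> (\<forall>v\<in>K. (A *v u' j - lam' j *\<^sub>R u' j) \<bullet> v = 0)) \<and>
     (\<forall>j\<in>{1..m}. \<forall>l\<in>{1..m}. A_inner A (u' j) (u' l) = (if j = l then 1 else 0)) \<and>
     mono_on {1..m} lam'"

text \<open>The description determines a unique vector if \<open>A\<close> is symmetric positive definite and
  \<open>K\<close> is a subspace; see \<open>A_proj_ex1\<close> below.\<close>

definition A_proj :: "real ^ 'n ^ 'n \<Rightarrow> (real ^ 'n) set \<Rightarrow> real ^ 'n \<Rightarrow> real ^ 'n" where
  "A_proj A K x = (THE p. p \<in> K \<and> (\<forall>y\<in>K. A_inner A p y = A_inner A x y))"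

text \<open>The operator \<open>E\<^sub>m\<^sub>,\<^sub>k\<close>; see \<open>ritz_proj_ex1\<close> for the unique existence.\<close>

definition ritz_proj ::
  "real ^ 'n ^ 'n \<Rightarrow> (nat \<Rightarrow> real ^ 'n) \<Rightarrow> nat \<Rightarrow> real ^ 'n \<Rightarrow> real ^ 'n" where
  "ritz_proj A u' k w =
     (THE z. z \<in> span (u' ` {1..k}) \<and> (\<forall>i\<in>{1..k}. A_inner A z (u' i) = A_inner A w (u' i)))"

text \<open>The supremum is over a nonempty set that is bounded above (continuous image of the unit sphere),
  so the real \<open>SUP\<close> is the genuine one.\<close>

definition eta :: "real ^ 'n ^ 'n \<Rightarrow> (real ^ 'n) set \<Rightarrow> real" where
  "eta A K = (SUP g\<in>{g. norm g = 1}.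
     A_norm A (matrix_inv A *v g - A_proj A K (matrix_inv A *v g)))"

definition ritz_gap :: "(nat \<Rightarrow> real) \<Rightarrow> (nat \<Rightarrow> real) \<Rightarrow> nat \<Rightarrow> nat \<Rightarrow> nat \<Rightarrow> real" where
  "ritz_gap lam lam' m k i = Min ((\<lambda>j. \<bar>1 / lam' j - 1 / lam i\<bar>) ` {k<..m})"

lemma A_inner_diff_left: "A_inner A (x - y) z = A_inner A x z - A_inner A y z"
  by (simp add: A_inner_def inner_diff_left)

lemma subspace_A_inner_eq: "subspace {y. A_inner A p y = A_inner A x y}"
  by (rule subspaceI)
     (simp_all add: A_inner_def matrix_vector_right_distrib inner_add_right matrix_vector_mult_scaleR)

lemma spd_zero: "spd_matrix A \<Longrightarrow> A_inner A z z = 0 \<Longrightarrow> z = 0"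
  unfolding spd_matrix_def A_inner_def by (metis less_irrefl)

lemma A_proj_ex1:
  fixes A :: "real ^ 'n ^ 'n"
  assumes "spd_matrix A" "subspace K"
  shows "\<exists>!p. p \<in> K \<and> (\<forall>y\<in>K. A_inner A p y = A_inner A x y)"
proof (rule ex_ex1I)
  have lin: "linear ((*v) A)" by simp
  have inj: "inj ((*v) A)"
  proof (rule injI)
    fix a b assume "A *v a = A *v b"
    then have "A_inner A (a - b) (a - b) = 0"
      by (simp add: A_inner_def matrix_vector_mult_diff_distrib)
    from spd_zero[OF assms(1) this] show "a = b" by simp
  qed
  define B where "B = (*v) A ` K"
  define T where "T = {q::real^'n. q \<in> UNIV \<and> (\<forall>b\<in>B. orthogonal b q)}"
  have sB: "subspace B" unfolding B_def using lin assms(2) by (rule linear_subspace_image)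
  have sT: "subspace T" unfolding T_def
    by (rule subspaceI) (auto simp: orthogonal_def inner_add_right)
  have dT: "dim T + dim B = DIM(real^'n)"
    using dim_subspace_orthogonal_to_vectors[OF sB subspace_UNIV] unfolding T_def by simp
  have dB: "dim B = dim K" unfolding B_def
    by (rule dim_image_eq[OF lin]) (rule inj_on_subset[OF inj subset_UNIV])
  have "K \<inter> T \<subseteq> {0}"
  proof
    fix z assume z: "z \<in> K \<inter> T"
    then have "(A *v z) \<bullet> z = 0" by (simp add: T_def B_def orthogonal_def)
    then have "A_inner A z z = 0" by (simp add: A_inner_def inner_commute)
    from spd_zero[OF assms(1) this] show "z \<in> {0}" by simp
  qed
  then have dKT: "dim (K \<inter> T) = 0" using dim_eq_0 by blast
  have "dim {a + b |a b. a \<in> K \<and> b \<in> T} = DIM(real^'n)"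
    using dim_sums_Int[OF assms(2) sT] dT dB dKT by linarith
  then have "span {a + b |a b. a \<in> K \<and> b \<in> T} = UNIV"
    by (rule iffD1[OF dim_eq_full])
  then have "{a + b |a b. a \<in> K \<and> b \<in> T} = UNIV"
    unfolding iffD2[OF span_eq_iff subspace_sums[OF assms(2) sT]] .
  then have "x \<in> {a + b |a b. a \<in> K \<and> b \<in> T}" by (simp only: UNIV_I)
  then obtain p q where pq: "x = p + q" "p \<in> K" "q \<in> T" by blast
  have "A_inner A p y = A_inner A x y" if "y \<in> K" for y
  proof -
    have "(A *v y) \<bullet> q = 0" using pq(3) that by (simp add: T_def B_def orthogonal_def)
    then show ?thesis by (simp add: A_inner_def pq(1) inner_add_left inner_commute[of q])
  qed
  with pq(2) show "\<exists>p. p \<in> K \<and> (\<forall>y\<in>K. A_inner A p y = A_inner A x y)" by blast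
next
  fix p q
  assume p: "p \<in> K \<and> (\<forall>y\<in>K. A_inner A p y = A_inner A x y)"
    and q: "q \<in> K \<and> (\<forall>y\<in>K. A_inner A q y = A_inner A x y)"
  then have "p - q \<in> K" using assms(2) subspace_diff by blast
  then have "A_inner A (p - q) (p - q) = 0" using p q by (simp add: A_inner_diff_left)
  from spd_zero[OF assms(1) this] show "p = q" by simp
qed

lemma ritz_proj_ex1:
  assumes "spd_matrix A"
  shows "\<exists>!z. z \<in> span (u' ` {1..k}) \<and> (\<forall>i\<in>{1..k}. A_inner A z (u' i) = A_inner A w (u' i))"
proof -
  let ?S = "span (u' ` {1..k})"
  have eq: "(\<forall>i\<in>{1..k}. A_inner A z (u' i) = A_inner A w (u' i)) \<longleftrightarrow>
        (\<forall>y\<in>?S. A_inner A z y = A_inner A w y)" (is "?L z \<longleftrightarrow> ?R z") for z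
  proof
    assume "?L z"
    then have "u' ` {1..k} \<subseteq> {y. A_inner A z y = A_inner A w y}" by blast
    then have "?S \<subseteq> {y. A_inner A z y = A_inner A w y}"
      by (rule span_minimal) (rule subspace_A_inner_eq)
    then show "?R z" by blast
  next
    assume "?R z"
    then show "?L z" by (blast intro: span_base)
  qed
  show ?thesis unfolding eq by (rule A_proj_ex1[OF assms subspace_span])
qed

end

theory Submission
  imports Defs
begin

text \<open>
  Write \<open>a\<close> for the energy inner product \<open>A_inner A\<close>, \<open>P\<close> for the \<open>a\<close>-orthogonal projection onto
  \<open>K\<close>, and \<open>\<mu>\<close>, \<open>\<mu>'\<close> for the reciprocals of the eigenvalues and of the Ritz values.
  The error \<open>u - E u\<close> of an eigenvector \<open>u\<close> is the sum of \<open>w = u - P u\<close>, which is \<open>a\<close>-orthogonal to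
  \<open>K\<close>, and \<open>z = P u - E u\<close>, which lies in \<open>K\<close> and is the sum of \<open>a u (u' j) u' j\<close> over
  \<open>k < j \<le> m\<close>.  So everything is reduced to bounding \<open>w\<close> in the Euclidean norm and \<open>z\<close> in both norms
  by \<open>w\<close>.

  For \<open>w\<close> a duality argument of Aubin-Nitsche type (\<open>norm_le_eta_A_norm\<close>) gives
  \<open>norm w \<le> eta * A_norm w\<close>.  For \<open>z\<close> the eigenvalue equation and the Ritz condition, both tested
  against the other vector, combine to \<open>(\<mu>' j - \<mu>) a u (u' j) = - w \<bullet> u' j\<close>
  (\<open>ritz_coefficient\<close>).  The gap bounds the factor on the left from below, and since
  Ritz vectors are orthogonal also in the Euclidean sense, with squared length \<open>\<mu>' j\<close>, Bessel's
  inequality bounds the right-hand sides:  the squared \<open>A_norm\<close> of \<open>z\<close> is at most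
  \<open>\<mu>' (k+1) (norm w)\<^sup>2 / \<delta>\<^sup>2\<close>, and its squared Euclidean norm at most
  \<open>(\<mu>' (k+1) norm w / \<delta>)\<^sup>2\<close>.  Pythagoras for \<open>a\<close> yields the first estimate, and the
  triangle inequality together with \<open>A_norm w \<le> A_norm (u - E u)\<close> the second.
\<close>

section \<open>The energy inner product\<close>

lemma bilinear_A_inner: "bilinear (A_inner A)"
  unfolding bilinear_def A_inner_def
  by (auto intro!: linearI simp: inner_add_left inner_add_right matrix_vector_right_distrib
      matrix_vector_mult_scaleR)

lemma A_inner_commute:
  assumes "transpose A = A"
  shows "A_inner A x y = A_inner A y x"
  unfolding A_inner_def
  by (metis assms dot_lmul_matrix inner_commute transpose_matrix_vector)

lemma spd_A_inner_commute: "spd_matrix A \<Longrightarrow> A_inner A x y = A_inner A y x"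
  by (simp add: spd_matrix_def A_inner_commute)

lemma A_inner_nonneg: "spd_matrix A \<Longrightarrow> 0 \<le> A_inner A x x"
  unfolding spd_matrix_def A_inner_def by (cases "x = 0") (auto simp: less_imp_le)

lemma A_norm_nonneg: "spd_matrix A \<Longrightarrow> 0 \<le> A_norm A x"
  by (simp add: A_norm_def A_inner_nonneg)

lemma A_norm_square: "spd_matrix A \<Longrightarrow> (A_norm A x)\<^sup>2 = A_inner A x x"
  by (simp add: A_norm_def A_inner_nonneg)

lemma A_norm_pythagoras:
  assumes "spd_matrix A" "A_inner A x y = 0"
  shows "(A_norm A (x + y))\<^sup>2 = (A_norm A x)\<^sup>2 + (A_norm A y)\<^sup>2"
  using assms spd_A_inner_commute[OF assms(1), of x y]
  by (simp add: A_norm_square bilinear_ladd[OF bilinear_A_inner] bilinear_radd[OF bilinear_A_inner])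

lemma A_norm_le_add:
  assumes "spd_matrix A" "A_inner A x y = 0"
  shows "A_norm A x \<le> A_norm A (x + y)"
  using A_norm_pythagoras[OF assms] A_norm_nonneg[OF assms(1)]
  by (auto intro: power2_le_imp_le[of "A_norm A x" "A_norm A (x + y)"])

lemma A_inner_Cauchy_Schwarz:
  assumes "spd_matrix A"
  shows "A_inner A x y \<le> A_norm A x * A_norm A y"
proof (cases "y = 0")
  case True
  then show ?thesis by (simp add: A_norm_def A_inner_def)
next
  case False
  note bil = bilinear_lsub[OF bilinear_A_inner] bilinear_rsub[OF bilinear_A_inner]
    bilinear_lmul[OF bilinear_A_inner] bilinear_rmul[OF bilinear_A_inner]
  have pos: "A_inner A y y > 0"
    using assms False by (simp add: spd_matrix_def A_inner_def)
  \<comment> \<open>The value \<open>t\<close> minimises the energy of \<open>x - t y\<close>.\<close>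
  define t where "t = A_inner A x y / A_inner A y y"
  have "0 \<le> A_inner A (x - t *\<^sub>R y) (x - t *\<^sub>R y)"
    by (rule A_inner_nonneg[OF assms])
  also have "\<dots> = A_inner A x x - (A_inner A x y)\<^sup>2 / A_inner A y y"
    using pos spd_A_inner_commute[OF assms, of y x]
    by (simp add: bil t_def power2_eq_square field_simps)
  finally have "(A_inner A x y)\<^sup>2 \<le> (A_norm A x * A_norm A y)\<^sup>2"
    using pos by (simp add: A_norm_square[OF assms] power_mult_distrib field_simps)
  then show ?thesis
    by (rule power2_le_imp_le) (simp add: A_norm_nonneg[OF assms])
qed

section \<open>Orthogonal families\<close>

lemma bilinear_sum_orthogonal:
  fixes B :: "'a::real_vector \<Rightarrow> 'a \<Rightarrow> real"
  assumes "bilinear B" "finite J"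
    and orth: "\<And>j l. j \<in> J \<Longrightarrow> l \<in> J \<Longrightarrow> j \<noteq> l \<Longrightarrow> B (e j) (e l) = 0"
  shows "B (\<Sum>j\<in>J. c j *\<^sub>R e j) (\<Sum>j\<in>J. c j *\<^sub>R e j) = (\<Sum>j\<in>J. (c j)\<^sup>2 * B (e j) (e j))"
proof -
  have "B (\<Sum>j\<in>J. c j *\<^sub>R e j) (\<Sum>j\<in>J. c j *\<^sub>R e j) =
      (\<Sum>j\<in>J. \<Sum>l\<in>J. c j * (c l * B (e j) (e l)))"
    by (simp add: bilinear_sum[OF assms(1)] sum.cartesian_product bilinear_lmul[OF assms(1)]
        bilinear_rmul[OF assms(1)] mult.left_commute)
  also have "\<dots> = (\<Sum>j\<in>J. \<Sum>l\<in>J. if l = j then (c j)\<^sup>2 * B (e j) (e j) else 0)"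
    by (intro sum.cong refl) (auto simp: orth power2_eq_square)
  also have "\<dots> = (\<Sum>j\<in>J. (c j)\<^sup>2 * B (e j) (e j))"
    using assms(2) by simp
  finally show ?thesis .
qed

lemma norm_sum_orthogonal:
  fixes e :: "'i \<Rightarrow> 'a::euclidean_space"
  assumes "finite J" "\<And>j l. j \<in> J \<Longrightarrow> l \<in> J \<Longrightarrow> j \<noteq> l \<Longrightarrow> e j \<bullet> e l = 0"
  shows "(norm (\<Sum>j\<in>J. c j *\<^sub>R e j))\<^sup>2 = (\<Sum>j\<in>J. (c j)\<^sup>2 * (norm (e j))\<^sup>2)"
  using bilinear_sum_orthogonal[of "(\<bullet>)" J e c] assms
  by (simp add: bilinear_conv_bounded_bilinear bounded_bilinear_inner power2_norm_eq_inner)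

lemma Bessel_inequality_orthogonal:
  fixes e :: "'i \<Rightarrow> 'a::euclidean_space"
  assumes "finite J" "\<And>j l. j \<in> J \<Longrightarrow> l \<in> J \<Longrightarrow> j \<noteq> l \<Longrightarrow> e j \<bullet> e l = 0"
    and nz: "\<And>j. j \<in> J \<Longrightarrow> e j \<noteq> 0"
  shows "(\<Sum>j\<in>J. (w \<bullet> e j)\<^sup>2 / (norm (e j))\<^sup>2) \<le> (norm w)\<^sup>2"
proof -
  define c where "c j = (w \<bullet> e j) / (norm (e j))\<^sup>2" for j
  define s where "s = (\<Sum>j\<in>J. c j *\<^sub>R e j)"
  let ?S = "\<Sum>j\<in>J. (w \<bullet> e j)\<^sup>2 / (norm (e j))\<^sup>2"
  have ws: "w \<bullet> s = ?S"
    unfolding s_def by (simp add: inner_sum_right c_def power2_eq_square)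
  have "(norm s)\<^sup>2 = (\<Sum>j\<in>J. (c j)\<^sup>2 * (norm (e j))\<^sup>2)"
    unfolding s_def by (rule norm_sum_orthogonal[OF assms(1,2)])
  also have "\<dots> = ?S"
    by (intro sum.cong refl) (simp add: c_def nz power2_eq_square field_simps)
  finally have ss: "(norm s)\<^sup>2 = ?S" .
  have "0 \<le> (norm (w - s))\<^sup>2" by simp
  also have "\<dots> = (norm w)\<^sup>2 - 2 * (w \<bullet> s) + (norm s)\<^sup>2"
    by (simp add: power2_norm_eq_inner inner_diff_left inner_diff_right inner_commute[of s w])
  finally show ?thesis using ws ss by simp
qed

text \<open>As many \<open>A\<close>-orthonormal vectors of \<open>K\<close> as the dimension of \<open>K\<close> span \<open>K\<close>, so elements of
  \<open>K\<close> have a Fourier expansion.\<close>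

lemma A_orthonormal_expansion:
  fixes A :: "real ^ 'n ^ 'n"
  assumes fin: "finite J" and "dim K = card J" and "e ` J \<subseteq> K"
    and on: "\<And>j l. j \<in> J \<Longrightarrow> l \<in> J \<Longrightarrow> A_inner A (e j) (e l) = (if j = l then 1 else 0)"
    and "x \<in> K"
  shows "x = (\<Sum>j\<in>J. A_inner A x (e j) *\<^sub>R e j)"
proof -
  note bil = bilinear_ladd[OF bilinear_A_inner] bilinear_lmul[OF bilinear_A_inner]
    bilinear_lzero[OF bilinear_A_inner]
  have inj: "inj_on e J"
  proof (rule inj_onI, rule ccontr)
    fix j l assume "j \<in> J" "l \<in> J" "e j = e l" "j \<noteq> l"
    then show False using on[of j l] on[of l l] by simp
  qed
  have "independent (e ` J)"
  proof (rule independent_if_scalars_zero)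
    show "finite (e ` J)" using fin by simp
    fix f v
    assume s0: "(\<Sum>v\<in>e ` J. f v *\<^sub>R v) = 0" and "v \<in> e ` J"
    then obtain l where l: "l \<in> J" "v = e l" by blast
    have "0 = A_inner A (\<Sum>v\<in>e ` J. f v *\<^sub>R v) (e l)"
      unfolding s0 by (simp add: bil)
    also have "\<dots> = A_inner A (\<Sum>j\<in>J. f (e j) *\<^sub>R e j) (e l)"
      by (simp add: sum.reindex[OF inj])
    also have "\<dots> = (\<Sum>j\<in>J. f (e j) * A_inner A (e j) (e l))"
      by (simp add: A_inner_def inner_sum_left)
    also have "\<dots> = (\<Sum>j\<in>J. if j = l then f (e l) else 0)"
      using l by (intro sum.cong refl) (simp add: on)
    also have "\<dots> = f v" using fin l by simp
    finally show "f v = 0" by simp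
  qed
  then have "K \<subseteq> span (e ` J)"
    using card_ge_dim_independent[OF assms(3)] assms(2) inj by (simp add: card_image)
  moreover have "span (e ` J) \<subseteq> {x. (\<Sum>j\<in>J. A_inner A x (e j) *\<^sub>R e j) = x}"
  proof (rule span_minimal)
    let ?F = "\<lambda>x. \<Sum>j\<in>J. A_inner A x (e j) *\<^sub>R e j"
    have "?F (e l) = e l" if "l \<in> J" for l
    proof -
      have "?F (e l) = (\<Sum>j\<in>J. if j = l then e l else 0)"
        using that by (intro sum.cong refl) (simp add: on)
      then show ?thesis using fin that by simp
    qed
    then show "e ` J \<subseteq> {x. ?F x = x}" by blast
    have "?F (c *\<^sub>R x) = c *\<^sub>R ?F x" for c x
      by (simp add: bil scaleR_sum_right)
    then show "subspace {x. ?F x = x}"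
      by (intro subspaceI) (simp_all add: bil scaleR_left_distrib sum.distrib)
  qed
  ultimately have "x \<in> {x. (\<Sum>j\<in>J. A_inner A x (e j) *\<^sub>R e j) = x}"
    using \<open>x \<in> K\<close> by blast
  then show ?thesis by simp
qed

section \<open>Projections and the duality argument\<close>

lemma A_proj_in: "spd_matrix A \<Longrightarrow> subspace K \<Longrightarrow> A_proj A K x \<in> K"
  unfolding A_proj_def using theI'[OF A_proj_ex1] by blast

lemma A_proj_residual_orthogonal:
  assumes "spd_matrix A" "subspace K" "y \<in> K"
  shows "A_inner A (x - A_proj A K x) y = 0"
proof -
  have "A_inner A (A_proj A K x) y = A_inner A x y"
    using theI'[OF A_proj_ex1[OF assms(1,2), of x]] assms(3) unfolding A_proj_def by blast
  then show ?thesis by (simp add: A_inner_diff_left)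
qed

lemma ritz_proj_properties:
  assumes "spd_matrix A"
  shows "ritz_proj A u' k w \<in> span (u' ` {1..k})"
    and "i \<in> {1..k} \<Longrightarrow> A_inner A (ritz_proj A u' k w) (u' i) = A_inner A w (u' i)"
  using theI'[OF ritz_proj_ex1[OF assms, of u' k w]] unfolding ritz_proj_def by blast+

lemma spd_matrix_inv_right:
  fixes A :: "real ^ 'n ^ 'n"
  assumes "spd_matrix A"
  shows "A *v (matrix_inv A *v g) = g"
proof -
  have "x = 0" if "A *v x = 0" for x
    using spd_zero[OF assms, of x] that by (simp add: A_inner_def)
  then have "invertible A"
    by (simp add: invertible_left_inverse matrix_left_invertible_ker)
  then have "A ** matrix_inv A = mat 1"
    unfolding invertible_def matrix_inv_def by (rule someI2_ex) simp
  then show ?thesis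
    by (simp add: matrix_vector_mul_assoc)
qed

text \<open>A real supremum bounds its elements only if they are bounded.  Here the residual has at most
  the energy of \<open>A\<inverse> g\<close>, which is \<open>A\<inverse> g \<bullet> g\<close>.\<close>

lemma A_norm_residual_le_eta:
  fixes A :: "real ^ 'n ^ 'n"
  assumes "spd_matrix A" "subspace K" "norm g = 1"
  shows "A_norm A (matrix_inv A *v g - A_proj A K (matrix_inv A *v g)) \<le> eta A K"
  unfolding eta_def
proof (rule cSUP_upper)
  show "g \<in> {g. norm g = 1}" using assms by simp
  obtain C where C: "\<And>g. norm (matrix_inv A *v g) \<le> norm g * C"
    using bounded_linear.bounded[OF matrix_vector_mul_bounded_linear[of "matrix_inv A"]] by blast
  have "A_norm A (matrix_inv A *v h - A_proj A K (matrix_inv A *v h)) \<le> sqrt C"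
    if "norm h = 1" for h
  proof -
    let ?x = "matrix_inv A *v h"
    have "A_norm A (?x - A_proj A K ?x) \<le> A_norm A (?x - A_proj A K ?x + A_proj A K ?x)"
      by (rule A_norm_le_add[OF assms(1)])
        (rule A_proj_residual_orthogonal[OF assms(1,2) A_proj_in[OF assms(1,2)]])
    also have "\<dots> = sqrt (?x \<bullet> h)"
      by (simp add: A_norm_def A_inner_def spd_matrix_inv_right[OF assms(1)])
    also have "?x \<bullet> h \<le> C"
      using norm_cauchy_schwarz[of ?x h] C[of h] that by simp
    finally show ?thesis by simp
  qed
  then show "bdd_above ((\<lambda>g. A_norm A (matrix_inv A *v g - A_proj A K (matrix_inv A *v g)))
      ` {g. norm g = 1})"
    by (auto intro!: bdd_aboveI2)
qed

lemma eta_nonneg: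
  fixes A :: "real ^ 'n ^ 'n"
  assumes "spd_matrix A" "subspace K"
  shows "0 \<le> eta A K"
proof -
  obtain g :: "real ^ 'n" where "norm g = 1" using vector_choose_size[of 1] by auto
  then show ?thesis
    using A_norm_residual_le_eta[OF assms] A_norm_nonneg[OF assms(1)] order_trans by blast
qed

text \<open>The Aubin-Nitsche argument:  with \<open>g = w / norm w\<close> the Euclidean norm of \<open>w\<close> is \<open>w \<bullet> g\<close>,
  the energy product of \<open>w\<close> with \<open>A\<inverse> g\<close>.  As \<open>w\<close> is orthogonal to \<open>K\<close>, the projection of \<open>A\<inverse> g\<close>
  may be subtracted before the Cauchy-Schwarz inequality is applied.\<close>

lemma norm_le_eta_A_norm:
  fixes A :: "real ^ 'n ^ 'n"
  assumes "spd_matrix A" "subspace K" and orth: "\<And>y. y \<in> K \<Longrightarrow> A_inner A w y = 0"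
  shows "norm w \<le> eta A K * A_norm A w"
proof (cases "w = 0")
  case True
  then show ?thesis by (simp add: A_norm_def A_inner_def)
next
  case False
  define g where "g = (1 / norm w) *\<^sub>R w"
  let ?x = "matrix_inv A *v g"
  have "norm g = 1" using False by (simp add: g_def)
  have "norm w = A_inner A w ?x"
    unfolding A_inner_def spd_matrix_inv_right[OF assms(1)] g_def
    using False by (simp add: dot_square_norm power2_eq_square)
  also have "\<dots> = A_inner A w (?x - A_proj A K ?x)"
    using orth[OF A_proj_in[OF assms(1,2)]] by (simp add: bilinear_rsub[OF bilinear_A_inner])
  also have "\<dots> \<le> A_norm A w * A_norm A (?x - A_proj A K ?x)"
    by (rule A_inner_Cauchy_Schwarz[OF assms(1)])
  also have "\<dots> \<le> A_norm A w * eta A K"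
    by (intro mult_left_mono A_norm_residual_le_eta A_norm_nonneg assms \<open>norm g = 1\<close>)
  finally show ?thesis by (simp add: mult.commute)
qed

section \<open>Ritz vectors\<close>

text \<open>Testing the Galerkin condition with another Ritz vector transfers the \<open>A\<close>-orthogonality of the
  Ritz vectors to the Euclidean inner product, where they have squared length \<open>1 / lam' j\<close>.\<close>

lemma ritz_vectors_inner:
  assumes "ritz_pairs A K m lam' u'" "j \<in> {1..m}" "l \<in> {1..m}"
  shows "lam' j * (u' j \<bullet> u' l) = (if j = l then 1 else 0)"
proof -
  have "(A *v u' j - lam' j *\<^sub>R u' j) \<bullet> u' l = 0"
    using assms by (auto simp: ritz_pairs_def)
  moreover have "A_inner A (u' l) (u' j) = (if j = l then 1 else 0)"
    using assms by (auto simp: ritz_pairs_def)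
  ultimately show ?thesis
    by (simp add: A_inner_def inner_diff_left inner_commute[of "u' l"])
qed

lemma ritz_value_pos:
  assumes "ritz_pairs A K m lam' u'" "j \<in> {1..m}"
  shows "0 < lam' j"
proof (rule ccontr)
  assume "\<not> 0 < lam' j"
  then have "lam' j * (u' j \<bullet> u' j) \<le> 0"
    by (intro mult_nonpos_nonneg) auto
  then show False using ritz_vectors_inner[OF assms assms(2)] by simp
qed

lemma ritz_vector_norm:
  assumes "ritz_pairs A K m lam' u'" "j \<in> {1..m}"
  shows "(norm (u' j))\<^sup>2 = 1 / lam' j"
  using ritz_vectors_inner[OF assms assms(2)] ritz_value_pos[OF assms]
  by (simp add: power2_norm_eq_inner field_simps)

text \<open>Both sides come from evaluating the energy product of \<open>u\<close> and \<open>v\<close> in two ways:  by the eigenvalue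
  equation it is \<open>lam * (u \<bullet> v)\<close>, and by the Galerkin condition, with \<open>u\<close> replaced by its
  projection, it is \<open>lam' * (P u \<bullet> v)\<close>.\<close>

lemma ritz_coefficient:
  fixes A :: "real ^ 'n ^ 'n"
  assumes "spd_matrix A" "subspace K"
    and "A *v u = lam *\<^sub>R u" "lam \<noteq> 0"
    and "v \<in> K" and galerkin: "\<And>y. y \<in> K \<Longrightarrow> (A *v v - lam' *\<^sub>R v) \<bullet> y = 0" and "lam' \<noteq> 0"
  shows "(1 / lam' - 1 / lam) * A_inner A u v = - ((u - A_proj A K u) \<bullet> v)"
proof -
  have "A_inner A u v = lam * (u \<bullet> v)"
    using spd_A_inner_commute[OF assms(1), of u v] assms(3)
    by (simp add: A_inner_def inner_commute)
  moreover have "A_inner A u v = lam' * (A_proj A K u \<bullet> v)"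
    using A_proj_residual_orthogonal[OF assms(1,2,5), of u]
      galerkin[OF A_proj_in[OF assms(1,2), of u]]
    by (simp add: A_inner_def inner_diff_left inner_diff_right inner_commute)
  ultimately show ?thesis
    using assms(4,7) by (simp add: inner_diff_left left_diff_distrib field_simps)
qed

text \<open>Projecting onto the first \<open>k\<close> Ritz vectors truncates the Fourier expansion of \<open>P x\<close>, and the
  Fourier coefficients of \<open>P x\<close> are those of \<open>x\<close>; the difference is the tail of the expansion.\<close>

lemma A_proj_minus_ritz_proj:
  fixes A :: "real ^ 'n ^ 'n"
  assumes spd: "spd_matrix A" and K: "subspace K" "dim K = m"
    and ritz: "ritz_pairs A K m lam' u'" and "k \<le> m"
  shows "A_proj A K x - ritz_proj A u' k x \<in> K"
    and "A_proj A K x - ritz_proj A u' k x = (\<Sum>j\<in>{k<..m}. A_inner A x (u' j) *\<^sub>R u' j)"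
proof -
  let ?E = "ritz_proj A u' k x"
  let ?z = "A_proj A K x - ?E"
  have uK: "u' j \<in> K" if "j \<in> {1..m}" for j
    using ritz that by (simp add: ritz_pairs_def)
  have "u' ` {1..k} \<subseteq> K" using uK \<open>k \<le> m\<close> by auto
  then have "?E \<in> K"
    using span_minimal[OF _ K(1)] ritz_proj_properties(1)[OF spd] by blast
  then show zK: "?z \<in> K"
    using A_proj_in[OF spd K(1)] K(1) by (simp add: subspace_diff)
  have on: "A_inner A (u' j) (u' l) = (if j = l then 1 else 0)"
    if "j \<in> {1..m}" "l \<in> {1..m}" for j l
    using ritz that by (simp add: ritz_pairs_def)
  have proj: "A_inner A (A_proj A K x) (u' j) = A_inner A x (u' j)" if "j \<in> {1..m}" for j
    using A_proj_residual_orthogonal[OF spd K(1) uK[OF that], of x] by (simp add: A_inner_diff_left)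
  have low: "A_inner A ?z (u' j) = 0" if "j \<in> {1..k}" for j
    using proj[of j] ritz_proj_properties(2)[OF spd that, of u' x] that \<open>k \<le> m\<close>
    by (simp add: A_inner_diff_left)
  have high: "A_inner A ?z (u' j) = A_inner A x (u' j)" if "j \<in> {k<..m}" for j
  proof -
    have "u' ` {1..k} \<subseteq> {y. A_inner A (u' j) y = A_inner A 0 y}"
      using that on by (auto simp: A_inner_def)
    then have "span (u' ` {1..k}) \<subseteq> {y. A_inner A (u' j) y = A_inner A 0 y}"
      by (rule span_minimal) (rule subspace_A_inner_eq)
    then have "A_inner A (u' j) ?E = 0"
      using ritz_proj_properties(1)[OF spd] by (auto simp: A_inner_def)
    then show ?thesis
      using proj[of j] that spd_A_inner_commute[OF spd, of ?E] by (simp add: A_inner_diff_left)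
  qed
  have "?z = (\<Sum>j\<in>{1..m}. A_inner A ?z (u' j) *\<^sub>R u' j)"
    by (rule A_orthonormal_expansion[where K = K]) (use K uK on zK in auto)
  also have "\<dots> = (\<Sum>j\<in>{k<..m}. A_inner A ?z (u' j) *\<^sub>R u' j)"
    by (rule sum.mono_neutral_right) (use low in auto)
  also have "\<dots> = (\<Sum>j\<in>{k<..m}. A_inner A x (u' j) *\<^sub>R u' j)"
    by (rule sum.cong) (use high in auto)
  finally show "?z = (\<Sum>j\<in>{k<..m}. A_inner A x (u' j) *\<^sub>R u' j)" .
qed

lemma ritz_gap_le:
  assumes "j \<in> {k<..m}"
  shows "ritz_gap lam lam' m k i \<le> \<bar>1 / lam' j - 1 / lam i\<bar>"
  unfolding ritz_gap_def by (rule Min_le) (use assms in auto)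

text \<open>In both norms, \<open>z\<close> is an orthogonal sum whose coefficients are controlled by
  \<open>ritz_coefficient\<close> and Bessel's inequality.  A Ritz vector has energy norm \<open>1\<close> but squared
  Euclidean norm \<open>1 / lam' j \<le> \<mu>\<close>, so the Euclidean bound, once squared, has one more factor \<open>\<mu>\<close>.\<close>

lemma ritz_tail_bounds:
  fixes A :: "real ^ 'n ^ 'n"
  assumes spd: "spd_matrix A" and K: "subspace K" "dim K = m"
    and ritz: "ritz_pairs A K m lam' u'" and "k < m"
    and eig: "A *v v = lam i *\<^sub>R v" "lam i \<noteq> 0"
    and gap: "0 < ritz_gap lam lam' m k i"
  defines "\<mu> \<equiv> 1 / lam' (k + 1)" and "\<delta> \<equiv> ritz_gap lam lam' m k i"
    and "w \<equiv> v - A_proj A K v" and "z \<equiv> A_proj A K v - ritz_proj A u' k v"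
  shows "(A_norm A z)\<^sup>2 \<le> \<mu> / \<delta>\<^sup>2 * (norm w)\<^sup>2" and "norm z \<le> \<mu> / \<delta> * norm w"
proof -
  let ?J = "{k<..m}"
  define c where "c j = A_inner A v (u' j)" for j
  have d: "0 < \<delta>" using gap by (simp add: \<delta>_def)
  have z: "z = (\<Sum>j\<in>?J. c j *\<^sub>R u' j)"
    unfolding z_def c_def
    by (rule A_proj_minus_ritz_proj(2)[OF spd K ritz]) (use \<open>k < m\<close> in simp)
  have in1: "j \<in> {1..m}" if "j \<in> ?J" for j using that by simp
  have pos: "0 < lam' j" if "j \<in> ?J" for j
    using ritz_value_pos[OF ritz in1[OF that]] .
  have nrm: "(norm (u' j))\<^sup>2 = 1 / lam' j" if "j \<in> ?J" for j
    using ritz_vector_norm[OF ritz in1[OF that]] .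
  have mu: "0 < \<mu>" unfolding \<mu>_def using pos[of "k + 1"] \<open>k < m\<close> by simp
  have mu_le: "1 / lam' j \<le> \<mu>" if "j \<in> ?J" for j
  proof -
    have "lam' (k + 1) \<le> lam' j"
      using ritz that by (auto simp: ritz_pairs_def intro!: mono_onD[of "{1..m}" lam'])
    then show ?thesis
      unfolding \<mu>_def using pos[of "k + 1"] \<open>k < m\<close> by (simp add: frac_le)
  qed
  have orth: "u' j \<bullet> u' l = 0" if "j \<in> ?J" "l \<in> ?J" "j \<noteq> l" for j l
    using ritz_vectors_inner[OF ritz in1[OF that(1)] in1[OF that(2)]] pos[OF that(1)] that(3) by simp
  have "(\<Sum>j\<in>?J. (w \<bullet> u' j)\<^sup>2 * lam' j) = (\<Sum>j\<in>?J. (w \<bullet> u' j)\<^sup>2 / (norm (u' j))\<^sup>2)"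
    by (intro sum.cong refl) (simp add: nrm)
  also have "\<dots> \<le> (norm w)\<^sup>2"
    by (rule Bessel_inequality_orthogonal) (use orth nrm pos in force)+
  finally have bessel: "(\<Sum>j\<in>?J. (w \<bullet> u' j)\<^sup>2 * lam' j) \<le> (norm w)\<^sup>2" .
  have coeff: "(c j)\<^sup>2 \<le> (w \<bullet> u' j)\<^sup>2 / \<delta>\<^sup>2" if "j \<in> ?J" for j
  proof -
    have "(1 / lam' j - 1 / lam i) * c j = - (w \<bullet> u' j)"
      unfolding c_def w_def
      by (rule ritz_coefficient[OF spd K(1) eig])
        (use ritz that pos[OF that] in \<open>auto simp: ritz_pairs_def\<close>)
    then have "\<bar>1 / lam' j - 1 / lam i\<bar> * \<bar>c j\<bar> = \<bar>w \<bullet> u' j\<bar>"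
      by (metis abs_minus_cancel abs_mult)
    moreover have "\<delta> * \<bar>c j\<bar> \<le> \<bar>1 / lam' j - 1 / lam i\<bar> * \<bar>c j\<bar>"
      unfolding \<delta>_def by (intro mult_right_mono ritz_gap_le that) simp
    ultimately have "\<delta> * \<bar>c j\<bar> \<le> \<bar>w \<bullet> u' j\<bar>" by simp
    then have "(\<delta> * \<bar>c j\<bar>)\<^sup>2 \<le> \<bar>w \<bullet> u' j\<bar>\<^sup>2"
      by (rule power_mono) (use d in simp)
    then show ?thesis using d by (simp add: power_mult_distrib field_simps)
  qed

  have "(A_norm A z)\<^sup>2 = (\<Sum>j\<in>?J. (c j)\<^sup>2 * A_inner A (u' j) (u' j))"
    unfolding A_norm_square[OF spd] z
    by (rule bilinear_sum_orthogonal[OF bilinear_A_inner])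
      (use ritz in \<open>auto simp: ritz_pairs_def\<close>)
  also have "\<dots> = (\<Sum>j\<in>?J. (c j)\<^sup>2)"
    by (intro sum.cong refl) (use ritz in \<open>auto simp: ritz_pairs_def\<close>)
  also have "\<dots> \<le> (\<Sum>j\<in>?J. \<mu> / \<delta>\<^sup>2 * ((w \<bullet> u' j)\<^sup>2 * lam' j))"
  proof (rule sum_mono)
    fix j assume j: "j \<in> ?J"
    have "1 \<le> \<mu> * lam' j" using mu_le[OF j] pos[OF j] by (simp add: field_simps)
    then have "(w \<bullet> u' j)\<^sup>2 / \<delta>\<^sup>2 * 1 \<le> (w \<bullet> u' j)\<^sup>2 / \<delta>\<^sup>2 * (\<mu> * lam' j)"
      by (rule mult_left_mono) simp
    with coeff[OF j] show "(c j)\<^sup>2 \<le> \<mu> / \<delta>\<^sup>2 * ((w \<bullet> u' j)\<^sup>2 * lam' j)"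
      by (simp add: mult_ac)
  qed
  also have "\<dots> \<le> \<mu> / \<delta>\<^sup>2 * (norm w)\<^sup>2"
    unfolding sum_distrib_left[symmetric] using mu bessel by (intro mult_left_mono) auto
  finally show "(A_norm A z)\<^sup>2 \<le> \<mu> / \<delta>\<^sup>2 * (norm w)\<^sup>2" .

  have "(norm z)\<^sup>2 = (\<Sum>j\<in>?J. (c j)\<^sup>2 * (norm (u' j))\<^sup>2)"
    unfolding z by (rule norm_sum_orthogonal) (use orth in auto)
  also have "\<dots> \<le> (\<Sum>j\<in>?J. \<mu>\<^sup>2 / \<delta>\<^sup>2 * ((w \<bullet> u' j)\<^sup>2 * lam' j))"
  proof (rule sum_mono)
    fix j assume j: "j \<in> ?J"
    have "(1 / lam' j)\<^sup>2 \<le> \<mu>\<^sup>2"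
      using mu_le[OF j] pos[OF j] by (intro power_mono) auto
    then have "1 / lam' j \<le> \<mu>\<^sup>2 * lam' j"
      using pos[OF j] by (simp add: power2_eq_square field_simps)
    with coeff[OF j]
    have "(c j)\<^sup>2 * (1 / lam' j) \<le> (w \<bullet> u' j)\<^sup>2 / \<delta>\<^sup>2 * (\<mu>\<^sup>2 * lam' j)"
      using pos[OF j] by (intro mult_mono) auto
    then show "(c j)\<^sup>2 * (norm (u' j))\<^sup>2 \<le> \<mu>\<^sup>2 / \<delta>\<^sup>2 * ((w \<bullet> u' j)\<^sup>2 * lam' j)"
      by (simp add: nrm[OF j] mult_ac)
  qed
  also have "\<dots> \<le> \<mu>\<^sup>2 / \<delta>\<^sup>2 * (norm w)\<^sup>2"
    unfolding sum_distrib_left[symmetric] using bessel by (intro mult_left_mono) auto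
  also have "\<dots> = (\<mu> / \<delta> * norm w)\<^sup>2"
    by (simp add: power_mult_distrib power_divide)
  finally show "norm z \<le> \<mu> / \<delta> * norm w"
    by (rule power2_le_imp_le) (use mu d in simp)
qed

section \<open>The error estimates\<close>

theorem theorem3p2:
  fixes A :: "real ^ 'n ^ 'n"
    and lam lam' :: "nat \<Rightarrow> real"
    and u u' :: "nat \<Rightarrow> real ^ 'n"
    and K :: "(real ^ 'n) set"
    and m k :: nat
  assumes "spd_matrix A"
    and "eigenpairs A lam u"
    and "subspace K" and "dim K = m"
    and "ritz_pairs A K m lam' u'"
    and "1 \<le> k" and "k < m"
    and "\<forall>i\<in>{1..k}. \<forall>j\<in>{k<..m}. \<bar>lam' i - lam i\<bar> \<le> \<bar>lam' j - lam i\<bar>"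
    and "\<forall>i\<in>{1..k}. ritz_gap lam lam' m k i > 0"
  shows "\<forall>i\<in>{1..k}.
      A_norm A (u i - ritz_proj A u' k (u i))
        \<le> sqrt (1 + (1 / lam' (k + 1)) / (ritz_gap lam lam' m k i)\<^sup>2 * (eta A K)\<^sup>2)
            * A_norm A (u i - A_proj A K (u i))
    \<and> norm (u i - ritz_proj A u' k (u i))
        \<le> (1 + (1 / lam' (k + 1)) / ritz_gap lam lam' m k i) * eta A K
            * A_norm A (u i - ritz_proj A u' k (u i))"
proof
  fix i assume i: "i \<in> {1..k}"
  note spd = assms(1) and K = assms(3,4) and ritz = assms(5)
  define \<mu> where "\<mu> = 1 / lam' (k + 1)"
  define \<delta> where "\<delta> = ritz_gap lam lam' m k i"
  define \<eta> where "\<eta> = eta A K"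
  define w where "w = u i - A_proj A K (u i)"
  define z where "z = A_proj A K (u i) - ritz_proj A u' k (u i)"
  have err: "u i - ritz_proj A u' k (u i) = w + z" by (simp add: w_def z_def)

  have d: "0 < \<delta>" using assms(9) i by (simp add: \<delta>_def)
  have mu: "0 < \<mu>"
    unfolding \<mu>_def using ritz_value_pos[OF ritz, of "k + 1"] \<open>k < m\<close> by simp
  have eta: "0 \<le> \<eta>" unfolding \<eta>_def by (rule eta_nonneg[OF spd K(1)])
  have "m \<le> CARD('n)" using dim_subset_UNIV[of K] K(2) by simp
  then have "i \<in> {1..CARD('n)}" using i \<open>k < m\<close> by simp
  then have eig: "A *v u i = lam i *\<^sub>R u i" and "A_inner A (u i) (u i) = 1"
    using assms(2) by (auto simp: eigenpairs_def)
  then have lam: "lam i \<noteq> 0" by (auto simp: A_inner_def)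

  have tail: "(A_norm A z)\<^sup>2 \<le> \<mu> / \<delta>\<^sup>2 * (norm w)\<^sup>2" "norm z \<le> \<mu> / \<delta> * norm w"
    unfolding \<mu>_def \<delta>_def w_def z_def
    using ritz_tail_bounds[where lam = lam and i = i, OF spd K ritz \<open>k < m\<close> eig lam] assms(9) i by auto
  have orth: "A_inner A w y = 0" if "y \<in> K" for y
    unfolding w_def by (rule A_proj_residual_orthogonal[OF spd K(1) that])
  have "z \<in> K"
    unfolding z_def
    by (rule A_proj_minus_ritz_proj(1)[OF spd K ritz]) (use \<open>k < m\<close> in simp)
  then have wz: "A_inner A w z = 0" by (rule orth)
  have duality: "norm w \<le> \<eta> * A_norm A w"
    unfolding \<eta>_def by (rule norm_le_eta_A_norm[OF spd K(1) orth])

  have "(A_norm A (w + z))\<^sup>2 \<le> (A_norm A w)\<^sup>2 + \<mu> / \<delta>\<^sup>2 * (norm w)\<^sup>2"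
    using A_norm_pythagoras[OF spd wz] tail(1) by simp
  also have "\<dots> \<le> (A_norm A w)\<^sup>2 + \<mu> / \<delta>\<^sup>2 * (\<eta> * A_norm A w)\<^sup>2"
    using mu duality by (intro add_left_mono mult_left_mono power_mono) auto
  also have "\<dots> = (1 + \<mu> / \<delta>\<^sup>2 * \<eta>\<^sup>2) * (A_norm A w)\<^sup>2"
    by (simp add: power_mult_distrib algebra_simps)
  also have "\<dots> = (sqrt (1 + \<mu> / \<delta>\<^sup>2 * \<eta>\<^sup>2) * A_norm A w)\<^sup>2"
    using mu by (simp add: power_mult_distrib)
  finally have energy: "A_norm A (w + z) \<le> sqrt (1 + \<mu> / \<delta>\<^sup>2 * \<eta>\<^sup>2) * A_norm A w"
    by (rule power2_le_imp_le) (use mu A_norm_nonneg[OF spd] in simp)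

  have "norm (w + z) \<le> (1 + \<mu> / \<delta>) * norm w"
    using norm_triangle_ineq[of w z] tail(2) by (simp add: algebra_simps)
  also have "\<dots> \<le> (1 + \<mu> / \<delta>) * (\<eta> * A_norm A w)"
    using mu d duality by (intro mult_left_mono) auto
  also have "\<dots> \<le> (1 + \<mu> / \<delta>) * (\<eta> * A_norm A (w + z))"
    using mu d eta A_norm_le_add[OF spd wz] by (intro mult_left_mono) auto
  finally have euclid: "norm (w + z) \<le> (1 + \<mu> / \<delta>) * \<eta> * A_norm A (w + z)"
    by (simp add: mult.assoc)

  show "A_norm A (u i - ritz_proj A u' k (u i))
        \<le> sqrt (1 + (1 / lam' (k + 1)) / (ritz_gap lam lam' m k i)\<^sup>2 * (eta A K)\<^sup>2)
            * A_norm A (u i - A_proj A K (u i))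
    \<and> norm (u i - ritz_proj A u' k (u i))
        \<le> (1 + (1 / lam' (k + 1)) / ritz_gap lam lam' m k i) * eta A K
            * A_norm A (u i - ritz_proj A u' k (u i))"
    using energy euclid unfolding err \<mu>_def \<delta>_def \<eta>_def w_def by blast
qed

end
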